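(* Let $t\ge0$, $\ell\ge1$ and $k\ge1$ be integers. Let $G$ be a graph contained in $H\boxtimes L\boxtimes K_\ell$, where $H$ and $L$ are graphs and $H$ has treewidth at most $t$. Let $d:=\Delta(G^{\lfloor k/2\rfloor})$ and $D:=\Delta(L^{\lfloor k/2\rfloor})$. Then $G^k$ is contained in $J\boxtimes L^{2\lfloor k/2\rfloor+1}\boxtimes K_{\ell(d+1)(D+1)}$ for some graph $J$ with treewidth at most $\binom{2\lfloor k/2\rfloor+t+1}{t}-1$.
   Context: Graphs are finite, simple, undirected. Contained means isomorphic to a subgraph. The strong product $G_1\boxtimes G_2$ has vertex set $V(G_1)\times V(G_2)$ with distinct $(a,v),(b,u)$ adjacent iff ($a=b$ or $ab\in E(G_1)$) and ($u=v$ or $uv\in E(G_2)$). For an integer $m\ge0$, the $m$-th power $G^m$ has vertex set $V(G)$ with distinct $u,v$ adjacent iff $\mathrm{dist}_G(u,v)\le m$ (so $G^0$ is edgeless). $\Delta$ denotes maximum degree and $K_n$ the complete graph on $n$ vertices. *)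

theory Defs
  imports Main
begin

type_synonym 'a graph = "'a set \<times> ('a \<times> 'a) set"

definition verts :: "'a graph \<Rightarrow> 'a set" where "verts G = fst G"
definition edges :: "'a graph \<Rightarrow> ('a \<times> 'a) set" where "edges G = snd G"

definition graph :: "'a graph \<Rightarrow> bool" where
  "graph G \<longleftrightarrow> finite (verts G) \<and> edges G \<subseteq> verts G \<times> verts G
     \<and> sym (edges G) \<and> irrefl (edges G)"

definition contained :: "'a graph \<Rightarrow> 'b graph \<Rightarrow> bool" where
  "contained G H \<longleftrightarrow> (\<exists>f. inj_on f (verts G) \<and> f ` verts G \<subseteq> verts H
     \<and> (\<forall>(x, y) \<in> edges G. (f x, f y) \<in> edges H))"

definition strong_prod :: "'a graph \<Rightarrow> 'b graph \<Rightarrow> ('a \<times> 'b) graph" where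
  "strong_prod G1 G2 = (verts G1 \<times> verts G2,
     {((a, v), (b, u)). (a, v) \<in> verts G1 \<times> verts G2 \<and> (b, u) \<in> verts G1 \<times> verts G2
        \<and> (a, v) \<noteq> (b, u)
        \<and> (a = b \<or> (a, b) \<in> edges G1) \<and> (u = v \<or> (u, v) \<in> edges G2)})"

definition complete :: "nat \<Rightarrow> nat graph" where
  "complete n = ({0..<n}, {(x, y). x < n \<and> y < n \<and> x \<noteq> y})"

definition walk :: "'a graph \<Rightarrow> 'a list \<Rightarrow> bool" where
  "walk G xs \<longleftrightarrow> xs \<noteq> [] \<and> set xs \<subseteq> verts G
     \<and> (\<forall>i. Suc i < length xs \<longrightarrow> (xs ! i, xs ! Suc i) \<in> edges G)"

definition dist_le :: "'a graph \<Rightarrow> 'a \<Rightarrow> 'a \<Rightarrow> nat \<Rightarrow> bool" where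
  "dist_le G u v m \<longleftrightarrow> (\<exists>xs. walk G xs \<and> hd xs = u \<and> last xs = v \<and> length xs \<le> m + 1)"

definition graph_power :: "'a graph \<Rightarrow> nat \<Rightarrow> 'a graph" where
  "graph_power G m = (verts G,
     {(u, v). u \<in> verts G \<and> v \<in> verts G \<and> u \<noteq> v \<and> dist_le G u v m})"

definition degree :: "'a graph \<Rightarrow> 'a \<Rightarrow> nat" where
  "degree G v = card {u. (v, u) \<in> edges G}"

definition max_degree :: "'a graph \<Rightarrow> nat" where
  "max_degree G = Max (insert 0 (degree G ` verts G))"

definition connected :: "'a graph \<Rightarrow> bool" where
  "connected G \<longleftrightarrow> (\<forall>u \<in> verts G. \<forall>v \<in> verts G.
     \<exists>xs. walk G xs \<and> hd xs = u \<and> last xs = v)"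

definition has_cycle :: "'a graph \<Rightarrow> bool" where
  "has_cycle G \<longleftrightarrow> (\<exists>xs. walk G xs \<and> distinct xs \<and> length xs \<ge> 3
     \<and> (last xs, hd xs) \<in> edges G)"

definition tree :: "'a graph \<Rightarrow> bool" where
  "tree T \<longleftrightarrow> graph T \<and> verts T \<noteq> {} \<and> connected T \<and> \<not> has_cycle T"

definition induced :: "'a graph \<Rightarrow> 'a set \<Rightarrow> 'a graph" where
  "induced G S = (verts G \<inter> S, edges G \<inter> (S \<times> S))"

definition tree_decomposition :: "'a graph \<Rightarrow> 'n graph \<Rightarrow> ('n \<Rightarrow> 'a set) \<Rightarrow> bool" where
  "tree_decomposition G T B \<longleftrightarrow> tree T
     \<and> (\<forall>x \<in> verts T. B x \<subseteq> verts G)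
     \<and> (\<forall>v \<in> verts G. \<exists>x \<in> verts T. v \<in> B x)
     \<and> (\<forall>(u, v) \<in> edges G. \<exists>x \<in> verts T. u \<in> B x \<and> v \<in> B x)
     \<and> (\<forall>v \<in> verts G. connected (induced T {x \<in> verts T. v \<in> B x}))"

text \<open>Treewidth at most t: a tree decomposition (with tree nodes of type nat,
  which is no loss of generality for finite trees) with all bags of size at most t+1.\<close>
definition treewidth_le :: "'a graph \<Rightarrow> nat \<Rightarrow> bool" where
  "treewidth_le G t \<longleftrightarrow> (\<exists>(T :: nat graph) B. tree_decomposition G T B
     \<and> (\<forall>x \<in> verts T. card (B x) \<le> t + 1))"

end

(*
  Number the vertices of H along a rooted tree decomposition, so that the lower neighbours U(v) of v
  in a chordal completion form a clique of size at most t.  Let J join two vertices when one is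
  reached from the other by at most 2r+1 descending steps, r = k div 2.  Removing the lowest element
  of U(v) gives Pascal's recurrence for the number of vertices so reached, and the sets of reached
  vertices are the bags of a decomposition of J along the elimination tree.

  A vertex v of G lies in the part of J given by the lowest vertex in the projection to H of its
  r-ball, attained at x(v), say, and in the part of the power of L given by its own L-coordinate.
  The rest of the colour records the K_l-coordinate of x(v), the position of v in the r-ball around
  x(v), and the position of the L-coordinate of x(v) in the r-ball around that of v; together
  these determine first x(v) and then v.
*)
theory Submission
  imports Defs
begin

section \<open>Walks, distances and reflexive adjacency\<close>

lemma walk_iff_successively:
  "walk G xs \<longleftrightarrow> xs \<noteq> [] \<and> set xs \<subseteq> verts G \<and> successively (\<lambda>x y. (x, y) \<in> edges G) xs"
  by (auto simp: walk_def successively_conv_nth)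

lemma walk_imp_rtrancl:
  assumes "walk G xs"
  shows "(hd xs, last xs) \<in> (edges G)\<^sup>*"
proof -
  have "successively (\<lambda>x y. (x, y) \<in> E) xs \<Longrightarrow> xs \<noteq> [] \<Longrightarrow> (hd xs, last xs) \<in> E\<^sup>*" for E
  proof (induction xs rule: induct_list012)
    case (3 x y zs)
    then show ?case by (auto intro: converse_rtrancl_into_rtrancl)
  qed auto
  then show ?thesis using assms by (simp add: walk_iff_successively)
qed

text \<open>Extend a path step by step; when the new endpoint already lies on the path, cut the path
  off there.\<close>

lemma rtrancl_imp_distinct_path:
  assumes "(a, b) \<in> E\<^sup>*" "a \<in> S" "E \<subseteq> S \<times> S"
  obtains xs where "xs \<noteq> []" "distinct xs" "set xs \<subseteq> S" "hd xs = a" "last xs = b"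
    "successively (\<lambda>x y. (x, y) \<in> E) xs"
proof -
  from assms(1) have "\<exists>xs. xs \<noteq> [] \<and> distinct xs \<and> set xs \<subseteq> S \<and> hd xs = a \<and> last xs = b
      \<and> successively (\<lambda>x y. (x, y) \<in> E) xs"
  proof (induction rule: rtrancl_induct)
    case base
    show ?case using assms(2) by (intro exI[of _ "[a]"]) auto
  next
    case (step b c)
    then obtain xs where xs: "xs \<noteq> []" "distinct xs" "set xs \<subseteq> S" "hd xs = a" "last xs = b"
      "successively (\<lambda>x y. (x, y) \<in> E) xs" by blast
    show ?case
    proof (cases "c \<in> set xs")
      case True
      then obtain ys zs where "xs = ys @ c # zs" by (meson split_list)
      then show ?thesis using xs
        by (intro exI[of _ "ys @ [c]"]) (auto simp: successively_append_iff hd_append)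
    next
      case False
      then show ?thesis using xs step(2) assms(3)
        by (intro exI[of _ "xs @ [c]"]) (auto simp: successively_append_iff)
    qed
  qed
  then show ?thesis using that by blast
qed

lemma connected_if_rtrancl:
  assumes "edges G \<subseteq> verts G \<times> verts G"
    and "\<And>u v. u \<in> verts G \<Longrightarrow> v \<in> verts G \<Longrightarrow> (u, v) \<in> (edges G)\<^sup>*"
  shows "connected G"
  unfolding connected_def
proof (intro ballI)
  fix u v assume uv: "u \<in> verts G" "v \<in> verts G"
  from rtrancl_imp_distinct_path[OF assms(2)[OF uv] uv(1) assms(1)]
  show "\<exists>xs. walk G xs \<and> hd xs = u \<and> last xs = v"
    unfolding walk_iff_successively by metis
qed

lemma connected_imp_rtrancl:
  assumes "connected G" "u \<in> verts G" "v \<in> verts G"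
  shows "(u, v) \<in> (edges G)\<^sup>*"
  using assms walk_imp_rtrancl unfolding connected_def by metis

text \<open>The loops make the \<open>m\<close>-th relational power mean distance at most
  \<open>m\<close> instead of a walk of length exactly \<open>m\<close>.\<close>

definition adj_eq :: "'a graph \<Rightarrow> ('a \<times> 'a) set" where
  "adj_eq G = edges G \<union> Id"

lemma adj_eq_relpow_mono: "(u, v) \<in> adj_eq G ^^ m \<Longrightarrow> m \<le> n \<Longrightarrow> (u, v) \<in> adj_eq G ^^ n"
proof (induction n)
  case (Suc n)
  then show ?case by (cases "m = Suc n") (auto simp: adj_eq_def relcomp.simps)
qed simp

lemma adj_eq_relpow_sym:
  assumes "graph G" "(u, v) \<in> adj_eq G ^^ m"
  shows "(v, u) \<in> adj_eq G ^^ m"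
  using assms(2)
proof (induction m arbitrary: v)
  case (Suc m)
  then obtain w where "(u, w) \<in> adj_eq G ^^ m" "(w, v) \<in> adj_eq G" by auto
  moreover from this have "(v, w) \<in> adj_eq G"
    using assms(1) by (auto simp: adj_eq_def graph_def sym_def)
  ultimately show ?case using Suc.IH relpow_Suc_I2 by metis
qed simp

lemma adj_eq_relpow_verts:
  "graph G \<Longrightarrow> (u, v) \<in> adj_eq G ^^ m \<Longrightarrow> u \<in> verts G \<Longrightarrow> v \<in> verts G"
  by (induction m arbitrary: v) (auto simp: adj_eq_def graph_def)

text \<open>Loops pad a short walk to length \<open>m\<close>; conversely, stationary steps are
  dropped.\<close>

lemma dist_le_iff_relpow:
  assumes "graph G" "u \<in> verts G"
  shows "dist_le G u v m \<longleftrightarrow> (u, v) \<in> adj_eq G ^^ m"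
proof
  assume "dist_le G u v m"
  then obtain xs where xs: "walk G xs" "hd xs = u" "last xs = v" "length xs \<le> m + 1"
    unfolding dist_le_def by blast
  have "successively (\<lambda>x y. (x, y) \<in> edges G) xs \<Longrightarrow> xs \<noteq> []
      \<Longrightarrow> (hd xs, last xs) \<in> adj_eq G ^^ (length xs - 1)"
  proof (induction xs rule: induct_list012)
    case (3 x y zs)
    then have "(x, y) \<in> adj_eq G" "(y, last (y # zs)) \<in> adj_eq G ^^ length zs"
      by (auto simp: adj_eq_def)
    then show ?case using relpow_Suc_I2 by fastforce
  qed auto
  then show "(u, v) \<in> adj_eq G ^^ m"
    using xs adj_eq_relpow_mono[of u v "length xs - 1" G m] by (auto simp: walk_iff_successively)
next
  assume "(u, v) \<in> adj_eq G ^^ m"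
  then show "dist_le G u v m"
  proof (induction m arbitrary: v)
    case 0
    then show ?case using assms unfolding dist_le_def walk_def by (intro exI[of _ "[u]"]) auto
  next
    case (Suc m)
    then obtain w where w: "(u, w) \<in> adj_eq G ^^ m" "(w, v) \<in> adj_eq G" by auto
    from Suc.IH[OF w(1)] obtain xs where xs: "walk G xs" "hd xs = u" "last xs = w" "length xs \<le> m + 1"
      unfolding dist_le_def by blast
    show ?case
    proof (cases "w = v")
      case True
      then show ?thesis using xs unfolding dist_le_def by (intro exI[of _ xs]) auto
    next
      case False
      then have "(w, v) \<in> edges G" "v \<in> verts G"
        using w assms(1) by (auto simp: adj_eq_def graph_def)
      then show ?thesis using xs unfolding dist_le_def walk_iff_successively
        by (intro exI[of _ "xs @ [v]"]) (auto simp: successively_append_iff)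
    qed
  qed
qed

lemma edges_graph_power_iff:
  assumes "graph G"
  shows "(u, v) \<in> edges (graph_power G m) \<longleftrightarrow> u \<in> verts G \<and> u \<noteq> v \<and> (u, v) \<in> adj_eq G ^^ m"
  using dist_le_iff_relpow[OF assms] adj_eq_relpow_verts[OF assms]
  by (auto simp: graph_power_def edges_def)

section \<open>Balls and their cardinality\<close>

definition ball :: "'a graph \<Rightarrow> nat \<Rightarrow> 'a \<Rightarrow> 'a set" where
  "ball G r v = {u. (v, u) \<in> adj_eq G ^^ r}"

text \<open>Without its centre, the ball is the neighbourhood of \<open>v\<close> in the
  \<open>r\<close>-th power; the centre accounts for the \<open>+ 1\<close>.\<close>

lemma ball_props:
  assumes "graph G" "v \<in> verts G"
  shows "v \<in> ball G r v" "ball G r v \<subseteq> verts G" "finite (ball G r v)"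
    "card (ball G r v) \<le> max_degree (graph_power G r) + 1"
proof -
  show 1: "v \<in> ball G r v" using adj_eq_relpow_mono[of v v 0 G r] by (simp add: ball_def)
  show 2: "ball G r v \<subseteq> verts G" using adj_eq_relpow_verts assms by (fastforce simp: ball_def)
  show 3: "finite (ball G r v)" using 2 assms(1) finite_subset by (auto simp: graph_def)
  have "{u. (v, u) \<in> edges (graph_power G r)} = ball G r v - {v}"
    using assms by (auto simp: edges_graph_power_iff ball_def)
  then have "degree (graph_power G r) v = card (ball G r v) - 1"
    using 1 3 by (simp add: degree_def)
  moreover have "degree (graph_power G r) v \<le> max_degree (graph_power G r)"
    unfolding max_degree_def using assms by (intro Max_ge) (auto simp: graph_def graph_power_def verts_def)
  ultimately show "card (ball G r v) \<le> max_degree (graph_power G r) + 1" by linarith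
qed

text \<open>Supplies the positions within balls that enter the colours of the embedding.\<close>

lemma ball_index:
  assumes "graph G"
  obtains idx where "\<And>v. v \<in> verts G \<Longrightarrow> inj_on (idx v) (ball G r v)"
    "\<And>v u. v \<in> verts G \<Longrightarrow> u \<in> ball G r v \<Longrightarrow> idx v u < max_degree (graph_power G r) + 1"
proof -
  have "\<exists>i. inj_on i (ball G r v) \<and> i ` ball G r v \<subseteq> {..<max_degree (graph_power G r) + 1}"
    if "v \<in> verts G" for v
    using ball_props(3,4)[OF assms that, of r] card_le_inj[of "ball G r v" "{..<max_degree (graph_power G r) + 1}"]
    by auto
  then show ?thesis using that by (metis image_subset_iff lessThan_iff)
qed

section \<open>Elimination orders\<close>

text \<open>\<open>U v\<close> stands for the lower neighbours of \<open>v\<close> in a chordal graph on the natural numbers.\<close>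
locale elimination_order =
  fixes U :: "nat \<Rightarrow> nat set"
  assumes lower: "u \<in> U v \<Longrightarrow> u < v"
    and clique: "a \<in> U v \<Longrightarrow> b \<in> U v \<Longrightarrow> a < b \<Longrightarrow> a \<in> U b"

text \<open>The \<open>insert v\<close> permits stopping early, so \<open>s\<close> bounds the
  number of descending steps.\<close>

fun reach :: "(nat \<Rightarrow> nat set) \<Rightarrow> nat \<Rightarrow> nat \<Rightarrow> nat set" where
  "reach U 0 v = {v}"
| "reach U (Suc s) v = insert v (\<Union>u\<in>U v. reach U s u)"

lemma self_in_reach [simp]: "v \<in> reach U s v"
  by (cases s) auto

lemma reach_Suc_mono: "w \<in> reach U s v \<Longrightarrow> w \<in> reach U (Suc s) v"
  by (induction s arbitrary: v) auto

lemma reach_subset: "(\<And>x. U x \<subseteq> V) \<Longrightarrow> v \<in> V \<Longrightarrow> reach U s v \<subseteq> V"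
proof (induction s arbitrary: v)
  case (Suc s)
  have "reach U s u \<subseteq> V" if "u \<in> U v" for u
    using Suc.IH Suc.prems(1) that by blast
  then show ?case using Suc.prems(2) by auto
qed simp

section \<open>Descents in an elimination order\<close>

context elimination_order
begin

lemma finite_U: "finite (U v)"
  using lower by (intro finite_subset[of "U v" "{..<v}"]) auto

lemma reach_le: "w \<in> reach U s v \<Longrightarrow> w \<le> v"
proof (induction s arbitrary: v)
  case (Suc s)
  then show ?case using lower by (fastforce intro: less_imp_le)
qed simp

lemma finite_reach: "finite (reach U s v)"
  using reach_le by (intro finite_subset[of "reach U s v" "{..v}"]) auto

text \<open>Let the descent from \<open>y\<close> begin with \<open>p\<close>. As \<open>p\<close>
  and \<open>q\<close> lie in the clique \<open>U y\<close>, they are equal or adjacent: for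
  \<open>p < q\<close> the vertex \<open>q\<close> steps to \<open>p\<close> directly, and for
  \<open>q < p\<close> the induction continues at \<open>p\<close>, with \<open>q\<close> in
  \<open>U p\<close>.\<close>

lemma reach_lower_neighbour: "w \<in> reach U s y \<Longrightarrow> q \<in> U y \<Longrightarrow> w \<le> q \<Longrightarrow> w \<in> reach U s q"
proof (induction s arbitrary: y)
  case 0
  then show ?case using lower by force
next
  case (Suc s)
  have "w \<noteq> y" using Suc.prems lower by force
  then obtain p where p: "p \<in> U y" "w \<in> reach U s p" using Suc.prems by auto
  consider "p = q" | "p < q" | "q < p" by linarith
  then show ?case
  proof cases
    case 1
    then show ?thesis using p reach_Suc_mono by metis
  next
    case 2
    then have "p \<in> U q" using clique p(1) Suc.prems(2) by blast
    then show ?thesis using p by auto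
  next
    case 3
    then have "q \<in> U p" using clique p(1) Suc.prems(2) by blast
    then show ?thesis using Suc.IH p(2) Suc.prems(3) reach_Suc_mono by blast
  qed
qed

text \<open>Follow a descent from \<open>y\<close> to \<open>q\<close> and apply
  \<open>reach_lower_neighbour\<close> at each step. The bound \<open>s\<close> survives however
  large \<open>n\<close> is.\<close>

lemma reach_between:
  "q \<in> reach U n y \<Longrightarrow> w \<in> reach U s y \<Longrightarrow> w \<le> q \<Longrightarrow> w \<in> reach U s q"
proof (induction n arbitrary: y)
  case (Suc n)
  show ?case
  proof (cases "q = y")
    case False
    then obtain p where p: "p \<in> U y" "q \<in> reach U n p" using Suc.prems by auto
    have "w \<le> p" using reach_le[OF p(2)] Suc.prems(3) by simp
    then have "w \<in> reach U s p" by (rule reach_lower_neighbour[OF Suc.prems(2) p(1)])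
    then show ?thesis using Suc.IH[OF p(2)] Suc.prems(3) by simp
  qed (use Suc.prems in simp)
qed simp

text \<open>Moving up from \<open>a\<close> to \<open>b\<close> costs one further step, moving down
  costs none; \<open>Suc s\<close> covers both.\<close>

lemma reach_step:
  assumes "w \<in> reach U s a" "w \<le> b" "a = b \<or> a \<in> U b \<or> b \<in> U a"
  shows "w \<in> reach U (Suc s) b"
  using assms(3)
proof (elim disjE)
  assume "a = b"
  then show ?thesis using assms(1) reach_Suc_mono by blast
next
  assume "a \<in> U b"
  then show ?thesis using assms(1) by auto
next
  assume "b \<in> U a"
  then have "w \<in> reach U s b" using reach_lower_neighbour assms by blast
  then show ?thesis by (rule reach_Suc_mono)
qed

end

text \<open>Induction on \<open>s + j\<close>, as the two halves of Pascal's recurrence lower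
  \<open>j\<close> and \<open>s\<close> respectively. The bound on \<open>card (U x)\<close> is
  asked only of vertices reached from \<open>v\<close>, because only for those is a drop guaranteed
  when the lowest element of \<open>U v\<close> is deleted.\<close>

lemma card_reach_le:
  assumes "elimination_order U"
    and "\<And>n x. x \<in> reach U n v \<Longrightarrow> card (U x) \<le> j"
  shows "card (reach U s v) \<le> (s + j) choose j"
  using assms
proof (induction "s + j" arbitrary: s j U v rule: less_induct)
  case less
  interpret elimination_order U by (rule less.prems)
  show ?case
  proof (cases "s = 0 \<or> U v = {}")
    case True
    then have "reach U s v = {v}" by (cases s) auto
    then show ?thesis by (simp add: Suc_le_eq)
  next
    case False
    then obtain s' where s: "s = Suc s'" by (cases s) auto
    have "card (U v) \<le> j" using less.prems(2)[of v 0] by simp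
    moreover have "card (U v) \<noteq> 0" using False finite_U by simp
    ultimately obtain j' where j: "j = Suc j'" by (cases j) auto
    \<comment> \<open>Vertices up to \<open>a\<close> are reached from \<open>a\<close> with one step fewer; the remaining ones are reached
      above \<open>a\<close>, where every vertex has lost its lower neighbour \<open>a\<close>.\<close>
    define a where "a = Min (U v)"
    have a: "a \<in> U v" "\<And>u. u \<in> U v \<Longrightarrow> a \<le> u"
      unfolding a_def using False finite_U by auto
    define U' where "U' x = U x \<inter> {a<..}" for x
    interpret U': elimination_order U'
    proof
      show "u < x" if "u \<in> U' x" for u x
        using that lower by (simp add: U'_def)
      show "b \<in> U' c" if "b \<in> U' x" "c \<in> U' x" "b < c" for b c x
        using that clique[of b x c] by (simp add: U'_def)
    qed
    have split: "reach U s v \<subseteq> reach U' s v \<union> reach U s' a"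
    proof
      fix w assume w: "w \<in> reach U s v"
      show "w \<in> reach U' s v \<union> reach U s' a"
      proof (cases "w \<le> a")
        case True
        then have "w \<noteq> v" using lower[OF a(1)] by auto
        then obtain p where p: "p \<in> U v" "w \<in> reach U s' p" using w s by auto
        then have "w \<in> reach U s' a"
          using a clique[OF a(1) p(1)] reach_lower_neighbour[OF p(2) _ True]
          by (cases "p = a") (auto simp: order.strict_iff_order)
        then show ?thesis by simp
      next
        case False
        \<comment> \<open>All vertices on a descent to \<open>w\<close> are at least
          \<open>w\<close>, hence above \<open>a\<close>, so the descent survives in
          \<open>U'\<close>.\<close>
        have "w \<in> reach U n y \<Longrightarrow> w \<in> reach U' n y" for n y
        proof (induction n arbitrary: y)
          case (Suc n)
          show ?case
          proof (cases "w = y")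
            case neq: False
            then obtain p where p: "p \<in> U y" "w \<in> reach U n p" using Suc.prems by auto
            moreover have "p > a" using reach_le[OF p(2)] False by linarith
            ultimately show ?thesis using Suc.IH U'_def by auto
          qed simp
        qed simp
        then show ?thesis using w by simp
      qed
    qed
    have "card (reach U' s v) \<le> (s + j') choose j'"
    proof (rule less.hyps)
      \<comment> \<open>Vertices reached in \<open>U'\<close> keep \<open>a\<close> as a lower
        neighbour in \<open>U\<close>: \<open>a\<close> and the next vertex \<open>p\<close> both
        lie in the clique \<open>U y\<close>, and \<open>a < p\<close>. So each of them loses an
        element in \<open>U'\<close>.\<close>
      have *: "x \<in> reach U' n y \<Longrightarrow> a \<in> U y \<Longrightarrow> a \<in> U x \<and> x \<in> reach U n y" for n x y
      proof (induction n arbitrary: y)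
        case (Suc n)
        show ?case
        proof (cases "x = y")
          case False
          then obtain p where p: "p \<in> U' y" "x \<in> reach U' n p" using Suc.prems by auto
          then have "p \<in> U y" "a < p" by (auto simp: U'_def)
          moreover from this have "a \<in> U p" using clique[OF Suc.prems(2)] by blast
          ultimately show ?thesis using Suc.IH[OF p(2)] by auto
        qed (use Suc.prems in simp)
      qed simp
      show "card (U' x) \<le> j'" if "x \<in> reach U' n v" for n x
      proof -
        have "card (U' x) \<le> card (U x - {a})"
          using finite_U by (intro card_mono) (auto simp: U'_def)
        moreover from *[OF that a(1)] have "a \<in> U x" "card (U x) \<le> j"
          by (blast intro: less.prems(2))+
        ultimately show ?thesis using finite_U j by simp
      qed
    qed (use j U'.elimination_order_axioms in simp_all)
    moreover have "card (reach U s' a) \<le> (s' + j) choose j"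
    proof (rule less.hyps)
      show "card (U x) \<le> j" if "x \<in> reach U n a" for n x
        by (rule less.prems(2)[of x "Suc n"]) (use that a(1) in auto)
    qed (use s less.prems(1) in simp_all)
    moreover have "card (reach U s v) \<le> card (reach U' s v) + card (reach U s' a)"
      using card_mono[OF _ split] finite_reach U'.finite_reach
      by (intro order.trans[OF _ card_Un_le]) simp
    moreover have "(s + j) choose j = ((s' + j) choose j) + ((s + j') choose j')"
      using binomial_Suc_Suc[of "s' + j" j'] by (simp add: s j)
    ultimately show ?thesis by linarith
  qed
qed

section \<open>Tree decompositions from elimination orders\<close>

text \<open>The nodes are all of \<open>{..N}\<close>, so that \<open>0\<close> can serve as the
  root whether or not it is a vertex of the decomposed graph; nodes that are not vertices later get
  empty bags.\<close>

definition parent_tree :: "(nat \<Rightarrow> nat) \<Rightarrow> nat \<Rightarrow> nat graph" where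
  "parent_tree p N =
     ({..N}, {(a, b). a \<le> N \<and> b \<le> N \<and> (0 < a \<and> b = p a \<or> 0 < b \<and> a = p b)})"

text \<open>Parents are smaller, so climbing inside \<open>S\<close> terminates, and it can end only
  at \<open>w\<close>.\<close>

lemma connected_induced_parent_tree:
  assumes "\<And>v. 0 < v \<Longrightarrow> p v < v" "S \<subseteq> {..N}"
    and "\<And>v. v \<in> S \<Longrightarrow> v \<noteq> w \<Longrightarrow> 0 < v \<and> p v \<in> S"
  shows "connected (induced (parent_tree p N) S)"
proof (rule connected_if_rtrancl)
  let ?E = "edges (induced (parent_tree p N) S)"
  have sym: "sym (?E\<^sup>*)"
    by (intro sym_rtrancl) (auto simp: sym_def induced_def parent_tree_def edges_def)
  have to_w: "(v, w) \<in> ?E\<^sup>*" if "v \<in> S" for v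
    using that
  proof (induction v rule: less_induct)
    case (less v)
    show ?case
    proof (cases "v = w")
      case False
      then have v: "0 < v" "p v \<in> S" "p v < v" using assms less.prems by auto
      then have "(v, p v) \<in> ?E"
        using less.prems assms(2) by (auto simp: induced_def parent_tree_def edges_def)
      then show ?thesis using less.IH v by (meson converse_rtrancl_into_rtrancl)
    qed simp
  qed
  show "(u, v) \<in> ?E\<^sup>*" if "u \<in> verts (induced (parent_tree p N) S)"
    "v \<in> verts (induced (parent_tree p N) S)" for u v
    using that to_w[of u] symD[OF sym to_w[of v]] by (auto simp: induced_def verts_def)
qed (auto simp: induced_def parent_tree_def verts_def edges_def)

lemma tree_parent_tree:
  assumes p: "\<And>v. 0 < v \<Longrightarrow> p v < v"
  shows "tree (parent_tree p N)"
proof -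
  let ?T = "parent_tree p N"
  have V: "verts ?T = {..N}" by (simp add: parent_tree_def verts_def)
  have "induced ?T {..N} = ?T"
    by (auto simp: induced_def parent_tree_def verts_def edges_def)
  moreover have "connected (induced ?T {..N})"
  proof (rule connected_induced_parent_tree[OF p])
    show "0 < v \<and> p v \<in> {..N}" if "v \<in> {..N}" "v \<noteq> 0" for v
      using that p[of v] by auto
  qed auto
  ultimately have "connected ?T" by simp
  moreover have "a \<noteq> p a" if "0 < a" for a
    using p[OF that] by simp
  then have "graph ?T"
    by (auto simp: graph_def parent_tree_def verts_def edges_def sym_def irrefl_def)
  moreover have "\<not> has_cycle ?T"
  \<comment> \<open>Both neighbours of the largest vertex on a cycle would be its parent.\<close>
  proof
    assume "has_cycle ?T"
    then obtain xs where xs: "walk ?T xs" "distinct xs" "length xs \<ge> 3"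
      "(last xs, hd xs) \<in> edges ?T" unfolding has_cycle_def by blast
    let ?n = "length xs"
    have cyc: "(xs ! i, xs ! (Suc i mod ?n)) \<in> edges ?T" if "i < ?n" for i
    proof (cases "Suc i = ?n")
      case True
      then have "i = ?n - 1" "xs \<noteq> []" by auto
      then have "xs ! i = last xs" "xs ! 0 = hd xs" by (simp_all add: last_conv_nth hd_conv_nth)
      then show ?thesis using xs(4) True by simp
    next
      case False
      then show ?thesis using xs(1) that by (simp add: walk_def)
    qed
    have down: "b = p a" if "(a, b) \<in> edges ?T \<or> (b, a) \<in> edges ?T" "b \<le> a" for a b
      using that p[of a] p[of b] by (auto simp: parent_tree_def edges_def)
    have "xs \<noteq> []" using xs(3) by auto
    then have "Max (set xs) \<in> set xs" by simp
    then obtain i where i: "i < ?n" "xs ! i = Max (set xs)" by (auto simp: in_set_conv_nth)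
    define j where "j = (if i = 0 then ?n - 1 else i - 1)"
    have j: "j < ?n" "Suc j mod ?n = i" using i(1) by (auto simp: j_def)
    let ?k = "Suc i mod ?n"
    have k: "?k < ?n" using i(1) by (intro mod_less_divisor) linarith
    have "xs ! j = p (xs ! i)" "xs ! ?k = p (xs ! i)"
      using cyc[OF j(1)] cyc[OF i(1)] j i k by (auto intro!: down)
    then have "j = ?k" using nth_eq_iff_index_eq[OF xs(2) j(1) k] by simp
    \<comment> \<open>For \<open>?n\<close> at least 3, the predecessor and the successor of
      \<open>i\<close> modulo \<open>?n\<close> are different indices.\<close>
    then show False using xs(3) i(1) by (cases "Suc i = ?n") (auto simp: j_def split: if_splits)
  qed
  ultimately show ?thesis using V unfolding tree_def by auto
qed

text \<open>With \<open>s = 2 * r + 1\<close> and \<open>V\<close> the numbers of the vertices of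
  \<open>H\<close>, this is the graph J of the theorem.\<close>

definition closeness_graph :: "(nat \<Rightarrow> nat set) \<Rightarrow> nat \<Rightarrow> nat set \<Rightarrow> nat graph" where
  "closeness_graph U s V = (V, {(a, b). a \<in> V \<and> b \<in> V \<and> a \<noteq> b \<and> (a \<in> reach U s b \<or> b \<in> reach U s a)})"

lemma graph_closeness_graph: "finite V \<Longrightarrow> graph (closeness_graph U s V)"
  by (auto simp: graph_def closeness_graph_def verts_def edges_def sym_def irrefl_def)

text \<open>The parent of \<open>x\<close> is the largest element of \<open>U x\<close>. A descent
  from \<open>x\<close> to some \<open>v \<noteq> x\<close> begins with an element of
  \<open>U x\<close>, so \<open>v\<close> is not above the parent and
  \<open>reach_lower_neighbour\<close> puts \<open>v\<close> into the parent's bag. Hence the nodes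
  whose bags contain \<open>v\<close> are connected.\<close>

lemma treewidth_closeness_graph:
  assumes "elimination_order U" "finite V"
    and U: "\<And>v. U v \<subseteq> V" "\<And>v. card (U v) \<le> t"
  shows "treewidth_le (closeness_graph U s V) (((s + t) choose t) - 1)"
proof -
  interpret elimination_order U by fact
  define N where "N = Max (insert 0 V)"
  have N: "V \<subseteq> {..N}" unfolding N_def using assms(2) by auto
  \<comment> \<open>The default \<open>0\<close> hangs nodes without lower neighbours at the root,
    which joins all components into one tree.\<close>
  define p where "p v = (if U v = {} then 0 else Max (U v))" for v
  have p_lower: "p v < v" if "0 < v" for v
    using that lower finite_U by (auto simp: p_def)
  define B where "B v = (if v \<in> V then reach U s v else {})" for v
  have sub: "B v \<subseteq> V" for v using reach_subset[OF U(1)] by (simp add: B_def)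
  have conn: "connected (induced (parent_tree p N) {x \<in> {..N}. v \<in> B x})" for v
  proof (rule connected_induced_parent_tree[OF p_lower])
    fix x assume x: "x \<in> {x \<in> {..N}. v \<in> B x}" "x \<noteq> v"
    then have vx: "v \<in> reach U s x" "x \<in> V" by (auto simp: B_def split: if_splits)
    then obtain q s' where q: "q \<in> U x" "v \<in> reach U s' q"
      using x(2) by (cases s) auto
    then have px: "p x = Max (U x)" by (auto simp: p_def)
    then have "p x \<in> U x" "q \<le> p x" using q finite_U by (auto intro!: Max_in)
    then have "v \<in> reach U s (p x)"
      using reach_lower_neighbour[OF vx(1)] reach_le[OF q(2)] by simp
    then show "0 < x \<and> p x \<in> {x \<in> {..N}. v \<in> B x}"
      using \<open>p x \<in> U x\<close> U(1) N lower by (fastforce simp: B_def)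
  qed auto
  have card: "card (B v) \<le> (s + t) choose t" for v
    using card_reach_le[OF assms(1) U(2)] by (simp add: B_def)
  have "tree_decomposition (closeness_graph U s V) (parent_tree p N) B"
    unfolding tree_decomposition_def
  proof (intro conjI)
    show "tree (parent_tree p N)" using p_lower by (rule tree_parent_tree)
    show "\<forall>v\<in>verts (closeness_graph U s V). \<exists>x\<in>verts (parent_tree p N). v \<in> B x"
      using N by (auto simp: closeness_graph_def parent_tree_def verts_def B_def intro!: bexI)
    show "\<forall>(u, v)\<in>edges (closeness_graph U s V). \<exists>x\<in>verts (parent_tree p N). u \<in> B x \<and> v \<in> B x"
    proof (clarify)
      fix u v assume "(u, v) \<in> edges (closeness_graph U s V)"
      then have uv: "u \<in> V" "v \<in> V" "u \<in> B v \<or> v \<in> B u"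
        by (auto simp: closeness_graph_def edges_def B_def)
      then have "u \<in> B u" "v \<in> B v" by (simp_all add: B_def)
      then show "\<exists>x\<in>verts (parent_tree p N). u \<in> B x \<and> v \<in> B x"
        using uv N unfolding parent_tree_def verts_def by auto
    qed
  qed (use sub conn in \<open>auto simp: closeness_graph_def parent_tree_def verts_def\<close>)
  \<comment> \<open>Positivity makes the truncated subtraction exact.\<close>
  moreover have "(s + t) choose t > 0" by simp
  ultimately show ?thesis unfolding treewidth_le_def
    using card by (intro exI[of _ "parent_tree p N"] exI[of _ B]) (auto simp: Suc_leI)
qed

section \<open>Elimination orders from tree decompositions\<close>

text \<open>Grow a connected vertex set one vertex at a time, giving each new vertex the largest
  rank so far. It has only one neighbour among the earlier vertices, since a path between two such
  neighbours would close a cycle.\<close>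

lemma tree_ranking:
  assumes "tree T"
  obtains rank :: "'n \<Rightarrow> nat" and par where "inj_on rank (verts T)"
    "\<And>x y. (x, y) \<in> edges T \<Longrightarrow> rank y < rank x \<Longrightarrow> y = par x"
proof -
  let ?V = "verts T" and ?E = "edges T"
  have T: "finite ?V" "?V \<noteq> {}" "?E \<subseteq> ?V \<times> ?V" "sym ?E" "irrefl ?E"
    using assms by (auto simp: tree_def graph_def)
  have "\<exists>S (rank :: 'n \<Rightarrow> nat) par. S \<subseteq> ?V \<and> card S = n \<and> inj_on rank S
      \<and> (\<forall>u \<in> S. \<forall>v \<in> S. (u, v) \<in> (?E \<inter> S \<times> S)\<^sup>*)
      \<and> (\<forall>x \<in> S. \<forall>y \<in> S. (x, y) \<in> ?E \<longrightarrow> rank y < rank x \<longrightarrow> y = par x)"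
    if "1 \<le> n" "n \<le> card ?V" for n
    using that
  proof (induction n rule: dec_induct)
    case base
    obtain r where "r \<in> ?V" using T by blast
    then show ?case using T(5) by (intro exI[of _ "{r}"]) (auto simp: irrefl_def)
  next
    case (step n)
    from step.IH[OF Suc_leD[OF step.prems]]
    obtain S and rank :: "'n \<Rightarrow> nat" and par where S: "S \<subseteq> ?V" "card S = n" "inj_on rank S"
      "\<And>u v. u \<in> S \<Longrightarrow> v \<in> S \<Longrightarrow> (u, v) \<in> (?E \<inter> S \<times> S)\<^sup>*"
      "\<And>x y. x \<in> S \<Longrightarrow> y \<in> S \<Longrightarrow> (x, y) \<in> ?E \<Longrightarrow> rank y < rank x \<Longrightarrow> y = par x"
      by blast
    have fin: "finite S" using S(1) T(1) finite_subset by blast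
    have "S \<noteq> {}" "S \<noteq> ?V" using S(2) step.hyps step.prems by auto
    then obtain a b where a: "a \<in> S" and b: "b \<in> ?V - S" using S(1) by blast
    have "(a, b) \<in> ?E\<^sup>*"
      using a b S(1) assms by (intro connected_imp_rtrancl) (auto simp: tree_def)
    \<comment> \<open>A walk from \<open>a\<close> in \<open>S\<close> to \<open>b\<close> outside
      must leave \<open>S\<close> along some edge; its outer end \<open>y\<close> is added
      next.\<close>
    then have "b \<notin> S \<longrightarrow> (\<exists>x y. (x, y) \<in> ?E \<and> x \<in> S \<and> y \<notin> S)"
      by (induction rule: rtrancl_induct) (use a in blast)+
    then obtain x y where xy: "(x, y) \<in> ?E" "x \<in> S" "y \<notin> S" using b by blast
    then have yx: "(y, x) \<in> ?E" "y \<in> ?V" using T by (auto dest: symD)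
    have uniq: "q = x" if q: "q \<in> S" "(y, q) \<in> ?E" for q
    proof (rule ccontr)
      assume "q \<noteq> x"
      obtain xs where xs: "xs \<noteq> []" "distinct xs" "set xs \<subseteq> S" "hd xs = x" "last xs = q"
        "successively (\<lambda>x y. (x, y) \<in> ?E \<inter> S \<times> S) xs"
        using rtrancl_imp_distinct_path[OF S(4)[OF xy(2) q(1)] xy(2)] by blast
      have "successively (\<lambda>x y. (x, y) \<in> ?E) xs"
        using xs(6) by (rule successively_mono) auto
      moreover have "(q, y) \<in> ?E" using q T(4) by (auto dest: symD)
      ultimately have "walk T (xs @ [y])"
        using xs S(1) yx by (auto simp: walk_iff_successively successively_append_iff)
      moreover have "length xs \<ge> 2"
        using xs(1,4,5) \<open>q \<noteq> x\<close> by (cases xs) (auto simp: Suc_le_eq split: if_splits)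
      ultimately have "has_cycle T"
        unfolding has_cycle_def using xs xy yx
        by (intro exI[of _ "xs @ [y]"]) (auto simp: hd_append)
      then show False using assms by (simp add: tree_def)
    qed
    define rank' where "rank' = rank(y := Suc (Max (rank ` S)))"
    have rank': "rank' z = rank z" "rank' z < rank' y" if "z \<in> S" for z
    proof -
      have "rank z \<le> Max (rank ` S)" using that fin by simp
      then show "rank' z = rank z" "rank' z < rank' y" using that xy(3) by (auto simp: rank'_def)
    qed
    have inj: "inj_on rank' (insert y S)"
    proof -
      have "inj_on rank' S" using S(3) rank'(1) inj_on_cong[of S rank' rank] by blast
      moreover have "rank' y \<notin> rank' ` S" using rank'(2) less_irrefl by (metis imageE)
      ultimately show ?thesis using xy(3) by simp
    qed
    let ?S = "insert y S"
    let ?R = "(?E \<inter> ?S \<times> ?S)\<^sup>*"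
    have sub: "(u, v) \<in> ?R" if "u \<in> S" "v \<in> S" for u v
      using S(4)[OF that] by (rule rtrancl_mono[THEN subsetD, rotated]) auto
    have y: "(u, y) \<in> ?R" "(y, u) \<in> ?R" if "u \<in> ?S" for u
    proof -
      have "(x, y) \<in> ?R" "(y, x) \<in> ?R" using xy yx by auto
      then show "(u, y) \<in> ?R" "(y, u) \<in> ?R"
        using that sub xy(2) by (auto intro: rtrancl_trans)
    qed
    have conn: "(u, v) \<in> ?R" if "u \<in> ?S" "v \<in> ?S" for u v
      using y that rtrancl_trans by metis
    have par: "z = (par(y := x)) w" if "w \<in> ?S" "z \<in> ?S" "(w, z) \<in> ?E" "rank' z < rank' w" for w z
    proof (cases "w = y")
      case True
      then show ?thesis using that uniq by auto
    next
      case False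
      then have "w \<in> S" using that by simp
      then have "z \<in> S" using that rank'(2)[of w] by auto
      then show ?thesis using \<open>w \<in> S\<close> that rank' S(5) False by auto
    qed
    show ?case
      using S(1,2) yx(2) xy(3) fin inj conn par
      by (intro exI[of _ ?S] exI[of _ rank'] exI[of _ "par(y := x)"]) auto
  qed
  from this[of "card ?V"] obtain S and rank :: "'n \<Rightarrow> nat" and par where
    "S \<subseteq> ?V" "card S = card ?V" "inj_on rank S"
    "\<forall>x \<in> S. \<forall>y \<in> S. (x, y) \<in> ?E \<longrightarrow> rank y < rank x \<longrightarrow> y = par x"
    using T by (auto simp: Suc_le_eq card_gt_0_iff)
  moreover from this have "S = ?V" using T(1) card_subset_eq by blast
  ultimately show ?thesis using that T(3) by blast
qed

text \<open>Work backwards along a walk in \<open>S\<close> from \<open>i\<close> to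
  \<open>m\<close>, keeping a chain of parent steps to \<open>m\<close>. A step to a parent prolongs
  the chain; for a step from \<open>y\<close> to a child \<open>z\<close>, the chain from
  \<open>z\<close> starts with \<open>y\<close>, and this first step is removed.\<close>

lemma connected_subtree_parent:
  assumes "graph T" "inj_on rank (verts T)"
    and par: "\<And>x y. (x, y) \<in> edges T \<Longrightarrow> rank y < rank x \<Longrightarrow> y = par x"
    and "S \<subseteq> verts T" "connected (induced T S)"
    and "i \<in> S" "m \<in> S" "\<And>j. j \<in> S \<Longrightarrow> rank m \<le> (rank j :: nat)" "i \<noteq> m"
  shows "par i \<in> S \<and> rank (par i) < rank i"
proof -
  define R where "R = {(y, par y) | y. y \<in> S \<and> par y \<in> S \<and> rank (par y) < rank y}"
  have "(i, m) \<in> (edges (induced T S))\<^sup>*"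
    using assms by (intro connected_imp_rtrancl) (auto simp: induced_def verts_def)
  then have "(i, m) \<in> R\<^sup>*"
  proof (induction rule: converse_rtrancl_induct)
    case (step y z)
    then have yz: "(y, z) \<in> edges T" "y \<in> S" "z \<in> S" by (auto simp: induced_def edges_def)
    then have "y \<noteq> z" "(z, y) \<in> edges T"
      using assms(1) by (auto simp: graph_def irrefl_def dest: symD)
    then have "rank y \<noteq> rank z" using yz assms(2,4) by (auto simp: inj_on_def)
    then consider "rank z < rank y" | "rank y < rank z" by linarith
    then show ?case
    proof cases
      case 1
      then have "(y, z) \<in> R" using yz par by (auto simp: R_def)
      then show ?thesis using step.IH by (rule converse_rtrancl_into_rtrancl)
    next
      case 2
      then have "y = par z" using par \<open>(z, y) \<in> edges T\<close> by blast
      moreover have "z \<noteq> m" using 2 assms(8) yz(2) by force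
      ultimately show ?thesis using step.IH by (auto simp: R_def elim: converse_rtranclE)
    qed
  qed simp
  then show ?thesis using \<open>i \<noteq> m\<close> by (auto simp: R_def elim: converse_rtranclE)
qed

text \<open>Order the vertices by \<open>top v\<close>, the node of least rank whose bag contains
  \<open>v\<close>, and let \<open>U\<close> collect the earlier vertices in the bag of
  \<open>top v\<close>. That bag contains \<open>v\<close> itself, which leaves at most
  \<open>t\<close> others.\<close>

lemma treewidth_le_elimination_order:
  fixes H :: "'b graph"
  assumes "graph H" "treewidth_le H t"
  obtains \<phi> U where "inj_on \<phi> (verts H)" "elimination_order U"
    "\<And>n. U n \<subseteq> \<phi> ` verts H" "\<And>n. card (U n) \<le> t"
    "\<And>x y. (x, y) \<in> edges H \<Longrightarrow> \<phi> x < \<phi> y \<Longrightarrow> \<phi> x \<in> U (\<phi> y)"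
proof -
  obtain T :: "nat graph" and B where TB: "tree_decomposition H T B"
    "\<And>x. x \<in> verts T \<Longrightarrow> card (B x) \<le> t + 1"
    using assms(2) unfolding treewidth_le_def by blast
  have T: "tree T" "\<And>x. x \<in> verts T \<Longrightarrow> B x \<subseteq> verts H"
    "\<And>v. v \<in> verts H \<Longrightarrow> \<exists>x \<in> verts T. v \<in> B x"
    "\<And>u v. (u, v) \<in> edges H \<Longrightarrow> \<exists>x \<in> verts T. u \<in> B x \<and> v \<in> B x"
    "\<And>v. v \<in> verts H \<Longrightarrow> connected (induced T {x \<in> verts T. v \<in> B x})"
    using TB(1) unfolding tree_decomposition_def by auto
  obtain rank :: "nat \<Rightarrow> nat" and par where rank: "inj_on rank (verts T)"
    "\<And>x y. (x, y) \<in> edges T \<Longrightarrow> rank y < rank x \<Longrightarrow> y = par x"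
    using tree_ranking[OF T(1)] by blast
  define top where "top v = arg_min rank (\<lambda>x. x \<in> verts T \<and> v \<in> B x)" for v
  have top: "top v \<in> verts T" "v \<in> B (top v)"
    "\<And>x. x \<in> verts T \<Longrightarrow> v \<in> B x \<Longrightarrow> rank (top v) \<le> rank x" if v: "v \<in> verts H" for v
  proof -
    obtain x where x: "x \<in> verts T \<and> v \<in> B x" using T(3)[OF v] by blast
    from arg_min_natI[of "\<lambda>x. x \<in> verts T \<and> v \<in> B x" _ rank, OF x]
    show "top v \<in> verts T" "v \<in> B (top v)" by (auto simp: top_def)
    show "rank (top v) \<le> rank x" if "x \<in> verts T" "v \<in> B x" for x
      unfolding top_def using that by (intro arg_min_nat_le) auto
  qed
  have step: "par i \<in> verts T \<and> v \<in> B (par i) \<and> rank (par i) < rank i"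
    if "v \<in> verts H" "i \<in> verts T" "v \<in> B i" "i \<noteq> top v" for v i
  proof -
    have "par i \<in> {x \<in> verts T. v \<in> B x} \<and> rank (par i) < rank i"
    proof (rule connected_subtree_parent[where m = "top v"])
      show "y = par x" if "(x, y) \<in> edges T" "rank y < rank x" for x y
        using rank(2) that by blast
    qed (use that top[OF that(1)] T(1) T(5)[OF that(1)] rank(1) in \<open>auto simp: tree_def\<close>)
    then show ?thesis by simp
  qed
  \<comment> \<open>Climb from \<open>i\<close> to \<open>top v\<close>. Before arrival the current
    node ranks above \<open>top v\<close>, hence above \<open>top u\<close>, so its parent still
    contains \<open>u\<close>.\<close>
  have nested: "u \<in> B (top v)"
    if "u \<in> verts H" "v \<in> verts H" "rank (top u) \<le> rank (top v)"
      "i \<in> verts T" "u \<in> B i" "v \<in> B i" for u v i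
    using that(4-)
  proof (induction "rank i" arbitrary: i rule: less_induct)
    case less
    show ?case
    proof (cases "i = top v")
      case False
      note v = step[OF that(2) less.prems(1,3) False]
      have "rank (top v) \<le> rank (par i)" using top(3)[OF that(2)] v by blast
      then have "i \<noteq> top u" using that(3) v by auto
      then show ?thesis using step[OF that(1) less.prems(1,2)] v less.hyps by blast
    qed (use less.prems in simp)
  qed
  have fin: "finite (verts H)" using assms(1) by (simp add: graph_def)
  obtain e :: "'b \<Rightarrow> nat" and N where e: "inj_on e (verts H)" "e ` verts H = {i. i < N}"
    using finite_imp_inj_to_nat_seg[OF fin] by auto
  \<comment> \<open>Lexicographic: the rank of \<open>top v\<close> decides, and
    \<open>e v < N\<close> breaks ties.\<close>
  define \<phi> where "\<phi> v = rank (top v) * N + e v" for v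
  have eN: "e v < N" if "v \<in> verts H" for v using that e(2) by auto
  have \<phi>_inj: "inj_on \<phi> (verts H)"
  proof (rule inj_onI)
    fix u v assume uv: "u \<in> verts H" "v \<in> verts H" "\<phi> u = \<phi> v"
    then have "\<phi> u mod N = \<phi> v mod N" by simp
    then have "e u = e v" using eN uv by (simp add: \<phi>_def)
    then show "u = v" using e(1) uv by (simp add: inj_on_def)
  qed
  have \<phi>_top: "rank (top u) \<le> rank (top v)" if "u \<in> verts H" "v \<in> verts H" "\<phi> u < \<phi> v" for u v
  proof (rule ccontr)
    assume "\<not> ?thesis"
    then have "Suc (rank (top v)) * N \<le> rank (top u) * N" by (intro mult_le_mono1) simp
    then show False using eN[OF that(2)] that(3) by (simp add: \<phi>_def)
  qed
  define U where "U n = {\<phi> u | u v. u \<in> verts H \<and> v \<in> verts H \<and> n = \<phi> v \<and> \<phi> u < \<phi> v \<and> u \<in> B (top v)}" for n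
  have "elimination_order U"
  proof
    show "a \<in> U b" if ab: "a \<in> U n" "b \<in> U n" "a < b" for a b n
    proof -
      obtain u v where u: "a = \<phi> u" "u \<in> verts H" "v \<in> verts H" "n = \<phi> v" "u \<in> B (top v)"
        using ab(1) by (auto simp: U_def)
      obtain w where w: "b = \<phi> w" "w \<in> verts H" "w \<in> B (top v)"
        using ab(2) u(3,4) \<phi>_inj by (auto simp: U_def inj_on_def)
      \<comment> \<open>Both \<open>u\<close> and \<open>w\<close> lie in the bag of
        \<open>top v\<close>, which serves as the common node in \<open>nested\<close>.\<close>
      have "u \<in> B (top w)"
        using nested[OF u(2) w(2) \<phi>_top _ u(5) w(3)] top(1)[OF u(3)] u w ab(3) by auto
      then show ?thesis using u w ab(3) by (auto simp: U_def)
    qed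
  qed (auto simp: U_def)
  moreover have "card (U n) \<le> t" for n
  proof (cases "n \<in> \<phi> ` verts H")
    case True
    then obtain v where v: "v \<in> verts H" "n = \<phi> v" by blast
    then have "U n \<subseteq> \<phi> ` (B (top v) - {v})"
      using \<phi>_inj by (auto simp: U_def inj_on_def)
    moreover have B: "finite (B (top v))" using T(2) top(1) v fin finite_subset by metis
    ultimately have "card (U n) \<le> card (B (top v) - {v})"
      by (meson card_image_le card_mono finite_Diff finite_imageI le_trans)
    then show ?thesis using TB(2)[OF top(1)] top(2) v B by fastforce
  next
    case False
    then have "U n = {}" by (auto simp: U_def)
    then show ?thesis by simp
  qed
  moreover have "\<phi> x \<in> U (\<phi> y)" if xy: "(x, y) \<in> edges H" "\<phi> x < \<phi> y" for x y
  proof -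
    have V: "x \<in> verts H" "y \<in> verts H" using xy assms(1) by (auto simp: graph_def)
    obtain i where "i \<in> verts T" "x \<in> B i" "y \<in> B i" using T(4) xy by blast
    then have "x \<in> B (top y)" using nested V \<phi>_top xy(2) by blast
    then show ?thesis using V xy by (auto simp: U_def)
  qed
  moreover have "U n \<subseteq> \<phi> ` verts H" for n by (auto simp: U_def)
  ultimately show ?thesis using that \<phi>_inj by blast
qed

section \<open>Powers of graphs in strong products\<close>

lemma verts_strong_prod: "verts (strong_prod A B) = verts A \<times> verts B"
  by (simp add: strong_prod_def verts_def)

lemma edges_strong_prod_iff:
  "((a, v), (b, u)) \<in> edges (strong_prod A B) \<longleftrightarrow>
     a \<in> verts A \<and> v \<in> verts B \<and> b \<in> verts A \<and> u \<in> verts B \<and> (a, v) \<noteq> (b, u)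
     \<and> (a = b \<or> (a, b) \<in> edges A) \<and> (u = v \<or> (u, v) \<in> edges B)"
  by (auto simp: strong_prod_def edges_def)

lemma verts_complete: "verts (complete n) = {..<n}"
  by (auto simp: complete_def verts_def)

lemma edges_complete_iff: "(i, j) \<in> edges (complete n) \<longleftrightarrow> i < n \<and> j < n \<and> i \<noteq> j"
  by (simp add: complete_def edges_def)

lemma verts_graph_power: "verts (graph_power G m) = verts G"
  by (simp add: graph_power_def verts_def)

lemma verts_closeness_graph: "verts (closeness_graph U s V) = V"
  by (simp add: closeness_graph_def verts_def)

lemma edges_closeness_graph_iff:
  "(a, b) \<in> edges (closeness_graph U s V) \<longleftrightarrow>
     a \<in> V \<and> b \<in> V \<and> a \<noteq> b \<and> (a \<in> reach U s b \<or> b \<in> reach U s a)"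
  by (simp add: closeness_graph_def edges_def)

text \<open>Since \<open>adj_eq\<close> has loops, the map may collapse edges, as the projections of
  a strong product do.\<close>

lemma adj_eq_relpow_map:
  assumes "\<And>x y. (x, y) \<in> adj_eq G \<Longrightarrow> (f x, f y) \<in> adj_eq L" "(u, v) \<in> adj_eq G ^^ m"
  shows "(f u, f v) \<in> adj_eq L ^^ m"
  using assms(2) by (induction m arbitrary: v) (auto dest: assms(1))

section \<open>Minima of balls under the vertex order\<close>

context elimination_order
begin

text \<open>Later \<open>g\<close> is the projection of \<open>G\<close> to \<open>H\<close>
  followed by the numbering of the vertices of \<open>H\<close>.\<close>

context
  fixes G :: "'a graph" and g :: "'a \<Rightarrow> nat"
  assumes comparable: "\<And>x y. (x, y) \<in> adj_eq G \<Longrightarrow> g x = g y \<or> g x \<in> U (g y) \<or> g y \<in> U (g x)"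
begin

text \<open>Let \<open>a'\<close> be the first vertex on the way from \<open>a\<close> to
  \<open>x\<close>. The ball around \<open>a'\<close> with radius one less lies in the given ball,
  so \<open>x\<close> is minimal there too.\<close>

lemma ball_min_reach_centre:
  assumes "(a, x) \<in> adj_eq G ^^ i" "\<And>z. (a, z) \<in> adj_eq G ^^ i \<Longrightarrow> g x \<le> g z"
  shows "g x \<in> reach U i (g a)"
  using assms
proof (induction i arbitrary: a)
  case (Suc i)
  obtain a' where a': "(a, a') \<in> adj_eq G" "(a', x) \<in> adj_eq G ^^ i"
    using relpow_Suc_D2[OF Suc.prems(1)] by blast
  have "g x \<in> reach U i (g a')"
  proof (rule Suc.IH[OF a'(2)])
    show "g x \<le> g z" if "(a', z) \<in> adj_eq G ^^ i" for z
      using Suc.prems(2) relpow_Suc_I2[OF a'(1) that] by blast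
  qed
  moreover have "g x \<le> g a"
    using adj_eq_relpow_mono[of a a 0 G "Suc i"] by (intro Suc.prems(2)) simp
  moreover have "g a' = g a \<or> g a' \<in> U (g a) \<or> g a \<in> U (g a')"
    using comparable[OF a'(1)] by auto
  ultimately show ?case by (rule reach_step)
qed simp

text \<open>Each step of the walk adds at most one by \<open>reach_step\<close>, which needs
  \<open>w\<close> not to exceed the values passed; all vertices passed are within distance
  \<open>i\<close> of \<open>a\<close>.\<close>

lemma reach_along_walk:
  assumes "w \<in> reach U s (g a)" "(a, y) \<in> adj_eq G ^^ i" "\<And>z. (a, z) \<in> adj_eq G ^^ i \<Longrightarrow> w \<le> g z"
  shows "w \<in> reach U (s + i) (g y)"
  using assms(2,3)
proof (induction i arbitrary: y)
  case 0
  then show ?case using assms(1) by simp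
next
  case (Suc i)
  obtain y' where y': "(a, y') \<in> adj_eq G ^^ i" "(y', y) \<in> adj_eq G"
    using Suc.prems(1) by auto
  have "w \<in> reach U (s + i) (g y')"
  proof (rule Suc.IH[OF y'(1)])
    show "w \<le> g z" if "(a, z) \<in> adj_eq G ^^ i" for z
      by (rule Suc.prems(2)) (rule adj_eq_relpow_mono[OF that], simp)
  qed
  from reach_step[OF this Suc.prems(2)[OF Suc.prems(1)] comparable[OF y'(2)]]
  show ?case by simp
qed

text \<open>The minimum is reached from the centre within \<open>r\<close> steps, and walking out to
  \<open>y\<close> inside the ball adds at most \<open>r\<close> more.\<close>

lemma ball_min_reach:
  assumes "x \<in> ball G r u" "\<And>z. z \<in> ball G r u \<Longrightarrow> g x \<le> g z" "y \<in> ball G r u"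
  shows "g x \<in> reach U (r + r) (g y)"
proof (rule reach_along_walk)
  show "g x \<in> reach U r (g u)"
    using assms by (intro ball_min_reach_centre) (auto simp: ball_def)
qed (use assms in \<open>auto simp: ball_def\<close>)

text \<open>An edge between the two balls gives a walk of length \<open>2r + 1\<close> from some \<open>z\<close> in the ball around
  \<open>v\<close> to \<open>xu\<close>.  Since \<open>g xv\<close> is reached from \<open>g z\<close> and is not below \<open>g xu\<close>, it inherits the bound
  \<open>2r + 1\<close>, although the obvious walk from \<open>xv\<close> to \<open>xu\<close> has length \<open>4r + 1\<close>.\<close>
lemma ball_minima_close:
  assumes "graph G"
    and xu: "xu \<in> ball G r u" "\<And>z. z \<in> ball G r u \<Longrightarrow> g xu \<le> g z"
    and xv: "xv \<in> ball G r v" "\<And>z. z \<in> ball G r v \<Longrightarrow> g xv \<le> g z"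
    and uv: "(u, v) \<in> adj_eq G ^^ (2 * r + 1)" and le: "g xu \<le> g xv"
  shows "g xu \<in> reach U (2 * r + 1) (g xv)"
proof -
  \<comment> \<open>The walk splits into \<open>r\<close> steps in the ball around \<open>u\<close>,
    one step from \<open>z'\<close> to \<open>z\<close>, and \<open>r\<close> steps in the ball
    around \<open>v\<close>.\<close>
  have "(u, v) \<in> adj_eq G ^^ r O adj_eq G ^^ Suc r"
    using uv by (simp only: relpow_add[symmetric]) (simp add: mult_2)
  then obtain z' where z': "(u, z') \<in> adj_eq G ^^ r" "(z', v) \<in> adj_eq G ^^ Suc r" by blast
  obtain z where z: "(z', z) \<in> adj_eq G" "(z, v) \<in> adj_eq G ^^ r"
    using relpow_Suc_D2[OF z'(2)] by blast
  have zv: "z \<in> ball G r v"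
    using adj_eq_relpow_sym[OF assms(1) z(2)] by (simp add: ball_def)
  have "g xu \<in> reach U (r + r) (g z')"
    using z'(1) by (intro ball_min_reach[OF xu]) (auto simp: ball_def)
  moreover have "g xu \<le> g z" using le xv(2)[OF zv] by linarith
  ultimately have "g xu \<in> reach U (Suc (r + r)) (g z)"
    using comparable[OF z(1)] by (rule reach_step)
  moreover have "g xv \<in> reach U (r + r) (g z)"
    by (rule ball_min_reach[OF xv zv])
  ultimately show ?thesis
    using reach_between[of "g xv" "r + r" "g z" "g xu" "Suc (r + r)"] le by (simp add: mult_2)
qed

end

end

section \<open>The embedding of the power of \<open>G\<close>\<close>

theorem theorem27:
  fixes G :: "'a graph" and H :: "'b graph" and L :: "'c graph" and t l k :: nat
  assumes "graph G" and "graph H" and "graph L"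
    and "l \<ge> 1" and "k \<ge> 1"
    and "treewidth_le H t"
    and "contained G (strong_prod (strong_prod H L) (complete l))"
  shows "let d = max_degree (graph_power G (k div 2));
             D = max_degree (graph_power L (k div 2))
         in \<exists>J :: nat graph. graph J
              \<and> treewidth_le J (((2 * (k div 2) + t + 1) choose t) - 1)
              \<and> contained (graph_power G k)
                  (strong_prod (strong_prod J (graph_power L (2 * (k div 2) + 1)))
                     (complete (l * (d + 1) * (D + 1))))"
proof -
  define r where "r = k div 2"
  define d where "d = max_degree (graph_power G r)"
  define D where "D = max_degree (graph_power L r)"
  obtain f where f: "inj_on f (verts G)"
    "f ` verts G \<subseteq> verts (strong_prod (strong_prod H L) (complete l))"
    "\<forall>(x, y) \<in> edges G. (f x, f y) \<in> edges (strong_prod (strong_prod H L) (complete l))"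
    using assms(7) unfolding contained_def by (elim exE conjE)
  define h where "h v = fst (fst (f v))" for v
  define lam where "lam v = snd (fst (f v))" for v
  define c where "c v = snd (f v)" for v
  have f_eq: "f v = ((h v, lam v), c v)" for v by (simp add: h_def lam_def c_def)
  have range: "h v \<in> verts H" "lam v \<in> verts L" "c v < l" if "v \<in> verts G" for v
    using f(2) that by (auto simp: f_eq image_subset_iff verts_strong_prod verts_complete)
  \<comment> \<open>The pair in \<open>L\<close> comes out reversed, as in the definition of
    \<open>strong_prod\<close>; symmetry of \<open>G\<close> then turns it round.\<close>
  have "(h x, h y) \<in> adj_eq H \<and> (lam y, lam x) \<in> adj_eq L" if "(x, y) \<in> edges G" for x y
    using bspec[OF f(3) that] by (auto simp: f_eq edges_strong_prod_iff adj_eq_def)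
  then have adj: "(h x, h y) \<in> adj_eq H" "(lam x, lam y) \<in> adj_eq L" if "(x, y) \<in> adj_eq G" for x y
    using that assms(1) by (auto simp: adj_eq_def graph_def dest: symD)
  obtain \<phi> U where U: "inj_on \<phi> (verts H)" "elimination_order U"
    "\<And>n. U n \<subseteq> \<phi> ` verts H" "\<And>n. card (U n) \<le> t"
    "\<And>x y. (x, y) \<in> edges H \<Longrightarrow> \<phi> x < \<phi> y \<Longrightarrow> \<phi> x \<in> U (\<phi> y)"
    using treewidth_le_elimination_order[OF assms(2,6)] by blast
  interpret elimination_order U by (rule U(2))
  define g where "g v = \<phi> (h v)" for v
  have comparable: "g x = g y \<or> g x \<in> U (g y) \<or> g y \<in> U (g x)" if "(x, y) \<in> adj_eq G" for x y
  proof (cases "h x = h y")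
    case False
    then have "(h x, h y) \<in> edges H" "(h y, h x) \<in> edges H"
      using adj(1)[OF that] assms(2) by (auto simp: adj_eq_def graph_def dest: symD)
    then show ?thesis using U(5) unfolding g_def by (meson linorder_neqE_nat)
  qed (simp add: g_def)
  \<comment> \<open>By the loops every ball contains its centre, so a minimiser exists for every
    \<open>v\<close>.\<close>
  have "\<exists>x \<in> ball G r v. \<forall>z \<in> ball G r v. g x \<le> g z" for v
    using ex_has_least_nat[of "\<lambda>x. x \<in> ball G r v" v g] adj_eq_relpow_mono[of v v 0 G r]
    by (auto simp: ball_def)
  then obtain x where x: "\<And>v. x v \<in> ball G r v" "\<And>v z. z \<in> ball G r v \<Longrightarrow> g (x v) \<le> g z"
    by metis
  have xV: "x v \<in> verts G" if "v \<in> verts G" for v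
    using x(1) ball_props(2)[OF assms(1) that] by blast
  have ball_x: "v \<in> ball G r (x v)" for v
    using x(1)[of v] adj_eq_relpow_sym[OF assms(1)] by (auto simp: ball_def)
  have lam_x: "lam (x v) \<in> ball L r (lam v)" for v
    using x(1)[of v] adj_eq_relpow_map[of G lam L, OF adj(2)] by (auto simp: ball_def)
  obtain iG where iG: "\<And>v. v \<in> verts G \<Longrightarrow> inj_on (iG v) (ball G r v)"
    "\<And>v u. v \<in> verts G \<Longrightarrow> u \<in> ball G r v \<Longrightarrow> iG v u < d + 1"
    using ball_index[OF assms(1)] unfolding d_def by blast
  obtain iL where iL: "\<And>v. v \<in> verts L \<Longrightarrow> inj_on (iL v) (ball L r v)"
    "\<And>v u. v \<in> verts L \<Longrightarrow> u \<in> ball L r v \<Longrightarrow> iL v u < D + 1"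
    using ball_index[OF assms(3)] unfolding D_def by blast
  let ?C = "{..<l} \<times> {..<d + 1} \<times> {..<D + 1}"
  have "\<exists>e. e ` ?C \<subseteq> {..<l * (d + 1) * (D + 1)} \<and> inj_on e ?C"
  proof (rule card_le_inj)
    show "card ?C \<le> card {..<l * (d + 1) * (D + 1)}"
      by (simp only: card_cartesian_product card_lessThan mult.assoc order.refl)
  qed auto
  then obtain enc :: "nat \<times> nat \<times> nat \<Rightarrow> nat" where enc: "inj_on enc ?C" "enc ` ?C \<subseteq> {..<l * (d + 1) * (D + 1)}"
    by blast
  define code where "code v = (c (x v), iG (x v) v, iL (lam v) (lam (x v)))" for v
  have code: "code v \<in> ?C" if "v \<in> verts G" for v
    using range(3)[OF xV] iG(2)[OF xV ball_x] iL(2)[OF range(2) lam_x] that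
    by (simp add: code_def)
  define F where "F v = ((g (x v), lam v), enc (code v))" for v
  have F_inj: "inj_on F (verts G)"
  proof (rule inj_onI)
    fix u v assume uv: "u \<in> verts G" "v \<in> verts G" "F u = F v"
    then have eq: "g (x u) = g (x v)" "lam u = lam v" "code u = code v"
      using enc(1) code by (auto simp: F_def dest: inj_onD)
    have "h (x u) = h (x v)"
      using eq(1) U(1) range(1) xV uv by (auto simp: g_def dest: inj_onD)
    \<comment> \<open>Both positions refer to the ball around the common point
      \<open>lam u = lam v\<close>, so equal positions mean equal points. The same argument in
      \<open>G\<close>, once \<open>x u = x v\<close> is known, recovers
      \<open>u = v\<close>.\<close>
    moreover have "lam (x u) = lam (x v)"
      using inj_onD[OF iL(1)[OF range(2)[OF uv(1)]]] eq lam_x[of u] lam_x[of v]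
      by (simp add: code_def)
    moreover have "c (x u) = c (x v)" using eq(3) by (simp add: code_def)
    ultimately have "f (x u) = f (x v)" by (simp add: f_eq)
    then have "x u = x v" using f(1) xV uv by (auto dest: inj_onD)
    then show "u = v"
      using inj_onD[OF iG(1)[OF xV[OF uv(1)]]] eq(3) ball_x[of u] ball_x[of v]
      by (simp add: code_def)
  qed
  let ?J = "closeness_graph U (2 * r + 1) (\<phi> ` verts H)"
  let ?L = "graph_power L (2 * r + 1)"
  let ?P = "strong_prod (strong_prod ?J ?L) (complete (l * (d + 1) * (D + 1)))"
  have fin: "finite (\<phi> ` verts H)" using assms(2) by (simp add: graph_def)
  have F_range: "F v \<in> verts ?P" if "v \<in> verts G" for v
    using range(1)[OF xV[OF that]] range(2)[OF that] enc(2) code[OF that]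
    by (auto simp: F_def g_def verts_strong_prod verts_closeness_graph verts_graph_power
        verts_complete image_subset_iff)
  have F_edge: "(F u, F v) \<in> edges ?P" if uv: "(u, v) \<in> edges (graph_power G k)" for u v
  proof -
    have V: "u \<in> verts G" "v \<in> verts G" "u \<noteq> v" and "(u, v) \<in> adj_eq G ^^ k"
      using uv assms(1) by (auto simp: edges_graph_power_iff dest: adj_eq_relpow_verts)
    \<comment> \<open>Here \<open>k\<close> is \<open>2 * r\<close> or
      \<open>2 * r + 1\<close>.\<close>
    moreover have "k \<le> 2 * r + 1" unfolding r_def by linarith
    ultimately have near: "(u, v) \<in> adj_eq G ^^ (2 * r + 1)"
      by (blast intro: adj_eq_relpow_mono)
    then have near': "(v, u) \<in> adj_eq G ^^ (2 * r + 1)"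
      by (rule adj_eq_relpow_sym[OF assms(1)])
    have close: "g (x a) \<in> reach U (2 * r + 1) (g (x b))"
      if "(a, b) \<in> adj_eq G ^^ (2 * r + 1)" "g (x a) \<le> g (x b)" for a b
      using ball_minima_close[where g = g and xu = "x a" and u = a and xv = "x b" and v = b,
          OF comparable assms(1) x(1) x(2) x(1) x(2) that] .
    have "g (x u) \<in> reach U (2 * r + 1) (g (x v)) \<or> g (x v) \<in> reach U (2 * r + 1) (g (x u))"
      using close[OF near] close[OF near'] nat_le_linear by blast
    then have J: "g (x u) = g (x v) \<or> (g (x u), g (x v)) \<in> edges ?J"
      using range(1) xV V by (auto simp: edges_closeness_graph_iff g_def)
    \<comment> \<open>The reversed walk is used because \<open>strong_prod\<close> reads its second
      factor in this order.\<close>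
    have "(lam v, lam u) \<in> adj_eq L ^^ (2 * r + 1)"
      using adj_eq_relpow_map[of G lam L, OF adj(2) near'] .
    then have L: "lam v = lam u \<or> (lam v, lam u) \<in> edges ?L"
      using range(2) V by (auto simp: edges_graph_power_iff[OF assms(3)])
    \<comment> \<open>Any two colours are equal or adjacent in the complete factor; injectivity
      supplies the distinctness that an edge of the product requires.\<close>
    have "F u \<noteq> F v" using F_inj V by (auto dest: inj_onD)
    then show ?thesis
      using F_range[OF V(1)] F_range[OF V(2)] J L
      by (auto simp: F_def edges_strong_prod_iff verts_strong_prod verts_complete edges_complete_iff)
  qed
  have "contained (graph_power G k) ?P"
    unfolding contained_def
    using F_inj F_range F_edge by (intro exI[of _ F]) (auto simp: verts_graph_power)
  moreover have "treewidth_le ?J (((2 * r + t + 1) choose t) - 1)"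
    using treewidth_closeness_graph[OF U(2) fin U(3,4), of "2 * r + 1"] by (simp add: add_ac)
  ultimately show ?thesis
    using graph_closeness_graph[OF fin] unfolding Let_def r_def d_def D_def by blast
qed

end
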